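(* Let $X$ be a vector space and $(Y,N)$ a fuzzy Banach space. Let $\varphi:X^3\to[0,\infty)$ be a function such that there exists $L<1$ with $$\varphi(x,y,z)\le2L\,\varphi\left(\frac x2,\frac y2,\frac z2\right)\quad\text{for all }x,y,z\in X.$$ Let $f:X\to Y$ be a mapping satisfying $$N\left(f\left(\frac{x+y+z}2\right)+f\left(\frac{x-y+z}2\right)-f(x)-f(z),t\right)\ge\frac t{t+\varphi(x,y,z)}$$ for all $x,y,z\in X$ and all $t>0$. Then $$A(x):=N\text{-}\lim_{n\to\infty}\frac{f(2^nx)}{2^n}$$ exists for each $x\in X$ and defines a unique additive mapping $A:X\to Y$ such that $$N(f(x)-A(x),t)\ge\frac{(2-2L)t}{(2-2L)t+\varphi(x,2x,x)}\quad\text{for all }x\in X,\ t>0.$$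
   Context: Vector spaces are real. A fuzzy norm on a real vector space $X$ is a function $N:X\times\mathbb{R}\to[0,1]$ such that for all $x,y\in X$, $s,t\in\mathbb{R}$: (N1) $N(x,t)=0$ for $t\le0$; (N2) $x=0$ iff $N(x,t)=1$ for all $t>0$; (N3) $N(cx,t)=N(x,t/|c|)$ if $c\ne0$; (N4) $N(x+y,s+t)\ge\min\{N(x,s),N(y,t)\}$; (N5) $N(x,\cdot)$ is non-decreasing and $\lim_{t\to\infty}N(x,t)=1$; (N6) for $x\ne0$, $N(x,\cdot)$ is continuous on $\mathbb{R}$. Then $(X,N)$ is a fuzzy normed space. A sequence $x_n$ converges to $x$, written $N\text{-}\lim_{n\to\infty}x_n=x$, if $\lim_{n\to\infty}N(x_n-x,t)=1$ for all $t>0$; it is Cauchy if for every $\epsilon>0$ and $t>0$ there is $n_0$ with $N(x_{n+p}-x_n,t)>1-\epsilon$ for all $n\ge n_0$, $p>0$. A fuzzy Banach space is a fuzzy normed space in which every Cauchy sequence converges. A mapping $A$ is additive if $A(x+y)=A(x)+A(y)$ for all $x,y$.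
   Formalization: The estimate for N(f(x)-A(x),t) is proved under the added assumption f(0)=0, without which it fails (f=1, φ=0 on the reals); existence of the limit, additivity and uniqueness are proved without it. *)

theory Defs
  imports Complex_Main
begin

text \<open>Vector spaces are types of class \<^class>\<open>real_vector\<close>.\<close>

locale fuzzy_norm =
  fixes N :: "'b::real_vector \<Rightarrow> real \<Rightarrow> real"
  assumes nonneg: "0 \<le> N x t"
    and le_one: "N x t \<le> 1"
    and nonpos: "t \<le> 0 \<Longrightarrow> N x t = 0"
    and zero_iff: "x = 0 \<longleftrightarrow> (\<forall>t>0. N x t = 1)"
    and scale: "c \<noteq> 0 \<Longrightarrow> N (c *\<^sub>R x) t = N x (t / \<bar>c\<bar>)"
    and triangle: "N (x + y) (s + t) \<ge> min (N x s) (N y t)"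
    and mono: "mono (N x)"
    and tendsto_one: "(N x \<longlongrightarrow> 1) at_top"
    and continuous: "x \<noteq> 0 \<Longrightarrow> continuous_on UNIV (N x)"

definition fuzzy_tendsto ::
    "('b::real_vector \<Rightarrow> real \<Rightarrow> real) \<Rightarrow> (nat \<Rightarrow> 'b) \<Rightarrow> 'b \<Rightarrow> bool" where
  "fuzzy_tendsto N s x \<longleftrightarrow> (\<forall>t>0. (\<lambda>n. N (s n - x) t) \<longlonglongrightarrow> 1)"

definition fuzzy_Cauchy ::
    "('b::real_vector \<Rightarrow> real \<Rightarrow> real) \<Rightarrow> (nat \<Rightarrow> 'b) \<Rightarrow> bool" where
  "fuzzy_Cauchy N s \<longleftrightarrow>
     (\<forall>e>0. \<forall>t>0. \<exists>n0. \<forall>n\<ge>n0. \<forall>p>0. N (s (n + p) - s n) t > 1 - e)"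

locale fuzzy_banach = fuzzy_norm N for N :: "'b::real_vector \<Rightarrow> real \<Rightarrow> real" +
  assumes complete: "fuzzy_Cauchy N s \<Longrightarrow> \<exists>x. fuzzy_tendsto N s x"

text \<open>
  The functional inequality is unchanged when a constant is added to \<open>f\<close>, whereas the
  stability estimate is not. The estimate therefore needs a normalisation such as
  \<open>f 0 = 0\<close>. Without it, \<open>f = 1\<close> and \<open>\<phi> = 0\<close> on the reals, with the fuzzy norm
  below, satisfy the inequality but no additive map satisfies the estimate.
\<close>

definition real_fuzzy_norm :: "real \<Rightarrow> real \<Rightarrow> real" where
  "real_fuzzy_norm x t = (if t \<le> 0 then 0 else t / (t + \<bar>x\<bar>))"

lemma frac_leI:
  fixes a b c d :: real
  assumes "b > 0" "d > 0" "a * d \<le> c * b"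
  shows "a / b \<le> c / d"
  using assms by (simp add: field_simps)

lemma fuzzy_norm_real: "fuzzy_norm real_fuzzy_norm"
proof
  fix x y s t c :: real
  show "0 \<le> real_fuzzy_norm x t" by (simp add: real_fuzzy_norm_def)
  show "real_fuzzy_norm x t \<le> 1" by (simp add: real_fuzzy_norm_def)
  show "t \<le> 0 \<Longrightarrow> real_fuzzy_norm x t = 0" by (simp add: real_fuzzy_norm_def)
  show "x = 0 \<longleftrightarrow> (\<forall>t>0. real_fuzzy_norm x t = 1)"
    by (auto simp: real_fuzzy_norm_def dest: spec[of _ 1])
  show "c \<noteq> 0 \<Longrightarrow> real_fuzzy_norm (c *\<^sub>R x) t = real_fuzzy_norm x (t / \<bar>c\<bar>)"
    by (auto simp: real_fuzzy_norm_def abs_mult field_simps zero_less_mult_iff)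
  show "real_fuzzy_norm (x + y) (s + t) \<ge> min (real_fuzzy_norm x s) (real_fuzzy_norm y t)"
  proof (cases "s \<le> 0 \<or> t \<le> 0")
    case True
    then have "min (real_fuzzy_norm x s) (real_fuzzy_norm y t) \<le> 0"
      by (auto simp: real_fuzzy_norm_def min_le_iff_disj)
    also have "0 \<le> real_fuzzy_norm (x + y) (s + t)"
      by (simp add: real_fuzzy_norm_def)
    finally show ?thesis .
  next
    case False
    then have st: "s > 0" "t > 0" by auto
    define a b where "a = \<bar>x\<bar>" and "b = \<bar>y\<bar>"
    have ab: "a \<ge> 0" "b \<ge> 0" by (auto simp: a_def b_def)
    have "min (s / (s + a)) (t / (t + b)) \<le> (s + t) / (s + t + (a + b))"
    proof (cases "s * b \<le> t * a")
      case True
      then have "s / (s + a) \<le> (s + t) / (s + t + (a + b))"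
        using st ab by (intro frac_leI) (auto simp: algebra_simps)
      then show ?thesis by linarith
    next
      case False
      then have "t / (t + b) \<le> (s + t) / (s + t + (a + b))"
        using st ab by (intro frac_leI) (auto simp: algebra_simps)
      then show ?thesis by linarith
    qed
    also have "\<dots> \<le> (s + t) / (s + t + \<bar>x + y\<bar>)"
      using st ab by (intro divide_left_mono) (auto simp: a_def b_def intro!: mult_pos_pos add_pos_nonneg)
    finally show ?thesis
      using st by (simp add: real_fuzzy_norm_def a_def b_def)
  qed
  show "mono (real_fuzzy_norm x)"
  proof (rule monoI)
    fix u v :: real
    assume uv: "u \<le> v"
    show "real_fuzzy_norm x u \<le> real_fuzzy_norm x v"
    proof (cases "u \<le> 0")
      case True
      then show ?thesis by (simp add: real_fuzzy_norm_def)
    next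
      case False
      with uv have "u / (u + \<bar>x\<bar>) \<le> v / (v + \<bar>x\<bar>)"
        by (intro frac_leI) (auto simp: algebra_simps mult_right_mono)
      with False uv show ?thesis by (simp add: real_fuzzy_norm_def)
    qed
  qed
  show "(real_fuzzy_norm x \<longlongrightarrow> 1) at_top"
  proof -
    have "((\<lambda>t. inverse (1 + \<bar>x\<bar> * inverse t)) \<longlongrightarrow> inverse (1 + \<bar>x\<bar> * 0)) at_top"
      by (intro tendsto_intros tendsto_inverse_0_at_top filterlim_ident) auto
    moreover have "eventually (\<lambda>t. inverse (1 + \<bar>x\<bar> * inverse t) = real_fuzzy_norm x t) at_top"
      using eventually_gt_at_top[of 0]
      by eventually_elim (auto simp: real_fuzzy_norm_def field_simps)
    ultimately show ?thesis by (simp add: tendsto_cong)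
  qed
  show "continuous_on UNIV (real_fuzzy_norm x)" if "x \<noteq> 0"
  proof -
    have "real_fuzzy_norm x = (\<lambda>t. max 0 t / (max 0 t + \<bar>x\<bar>))"
      by (auto simp: real_fuzzy_norm_def max_def fun_eq_iff)
    moreover have "max 0 t + \<bar>x\<bar> \<noteq> 0" for t
      using that by (auto simp: max_def)
    ultimately show ?thesis by (simp only:) (intro continuous_intros; auto)
  qed
qed

lemma fuzzy_banach_real: "fuzzy_banach real_fuzzy_norm"
proof -
  interpret fuzzy_norm real_fuzzy_norm by (rule fuzzy_norm_real)
  show ?thesis
  proof
    fix s :: "nat \<Rightarrow> real"
    assume C: "fuzzy_Cauchy real_fuzzy_norm s"
    have "Cauchy s"
    proof (rule metric_CauchyI)
      fix e :: real assume e: "e > 0"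
      define d where "d = e / 4"
      have d: "d > 0" using e by (simp add: d_def)
      obtain n0 where n0: "real_fuzzy_norm (s (n + p) - s n) d > 1 - 1/2" if "n \<ge> n0" "p > 0" for n p
        using C d unfolding fuzzy_Cauchy_def by (metis half_gt_zero_iff zero_less_one)
      have *: "\<bar>s (n + p) - s n\<bar> < d" if "n \<ge> n0" "p > 0" for n p
        using n0[OF that] d by (simp add: real_fuzzy_norm_def field_simps)
      have **: "\<bar>s m - s n0\<bar> < d" if "m \<ge> n0" for m
        using *[of n0 "m - n0"] that d by (cases "m = n0") auto
      show "\<exists>M. \<forall>m\<ge>M. \<forall>n\<ge>M. dist (s m) (s n) < e"
      proof (intro exI[of _ n0] allI impI)
        fix m n assume "m \<ge> n0" "n \<ge> n0"
        from this[THEN **] show "dist (s m) (s n) < e"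
          using d unfolding dist_real_def d_def by linarith
      qed
    qed
    then obtain x where x: "s \<longlonglongrightarrow> x"
      using Cauchy_convergent convergent_def by blast
    have "(\<lambda>n. real_fuzzy_norm (s n - x) t) \<longlonglongrightarrow> 1" if "t > 0" for t
    proof -
      have "(\<lambda>n. t / (t + \<bar>s n - x\<bar>)) \<longlonglongrightarrow> t / (t + \<bar>x - x\<bar>)"
        using that by (intro tendsto_intros x) auto
      then show ?thesis using that by (simp add: real_fuzzy_norm_def)
    qed
    then show "\<exists>x. fuzzy_tendsto real_fuzzy_norm s x"
      unfolding fuzzy_tendsto_def by blast
  qed
qed

lemma estimate_fails_without_normalisation:
  fixes L :: real
  defines "f \<equiv> (\<lambda>x::real. 1::real)" and "\<phi> \<equiv> (\<lambda>x y z::real. 0::real)"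
  assumes L: "L < 1"
  shows "\<forall>x y z. 0 \<le> \<phi> x y z \<and> \<phi> x y z \<le> 2 * L * \<phi> (x /\<^sub>R 2) (y /\<^sub>R 2) (z /\<^sub>R 2)"
    and "\<forall>x y z. \<forall>t>0.
      real_fuzzy_norm (f ((x + y + z) /\<^sub>R 2) + f ((x - y + z) /\<^sub>R 2) - f x - f z) t
        \<ge> t / (t + \<phi> x y z)"
    and "\<not> (\<exists>A. additive A \<and> (\<forall>x. \<forall>t>0. real_fuzzy_norm (f x - A x) t
        \<ge> (2 - 2 * L) * t / ((2 - 2 * L) * t + \<phi> x (2 *\<^sub>R x) x)))"
proof -
  show "\<forall>x y z. 0 \<le> \<phi> x y z \<and> \<phi> x y z \<le> 2 * L * \<phi> (x /\<^sub>R 2) (y /\<^sub>R 2) (z /\<^sub>R 2)"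
    by (simp add: \<phi>_def)
  show "\<forall>x y z. \<forall>t>0.
      real_fuzzy_norm (f ((x + y + z) /\<^sub>R 2) + f ((x - y + z) /\<^sub>R 2) - f x - f z) t
        \<ge> t / (t + \<phi> x y z)"
    by (simp add: f_def \<phi>_def real_fuzzy_norm_def)
  show "\<not> (\<exists>A. additive A \<and> (\<forall>x. \<forall>t>0. real_fuzzy_norm (f x - A x) t
        \<ge> (2 - 2 * L) * t / ((2 - 2 * L) * t + \<phi> x (2 *\<^sub>R x) x)))"
  proof
    assume "\<exists>A. additive A \<and> (\<forall>x. \<forall>t>0. real_fuzzy_norm (f x - A x) t
        \<ge> (2 - 2 * L) * t / ((2 - 2 * L) * t + \<phi> x (2 *\<^sub>R x) x))"
    then obtain A :: "real \<Rightarrow> real" where A: "additive A"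
      and est: "real_fuzzy_norm (f 0 - A 0) 1
        \<ge> (2 - 2 * L) * 1 / ((2 - 2 * L) * 1 + \<phi> 0 (2 *\<^sub>R 0) 0)"
      by (metis zero_less_one)
    have "A 0 = 0" by (rule additive.zero[OF A])
    with est L show False by (simp add: f_def \<phi>_def real_fuzzy_norm_def)
  qed
qed

end

theory Submission
  imports Defs
begin

text \<open>
  Subtracting the constant \<open>f 0\<close> from \<open>f\<close> changes neither the functional inequality nor the
  limits of \<open>f (2 ^ n x) / 2 ^ n\<close>. For \<open>g = f - f 0\<close> the choice \<open>(x, 2 x, x)\<close> in the inequality
  says that \<open>g (2 x)\<close> is close to \<open>2 g x\<close> with control \<open>\<psi> x = \<phi> x (2 x) x\<close>, and
  \<open>\<psi> (2 x) \<le> 2 L \<psi> x\<close>. This is the setting of Hyers' direct method. The estimate with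
  constant \<open>2 - 2 L\<close> reproduces itself when one more doubling is made: split the time \<open>t\<close> as
  \<open>L t + (1 - L) t\<close>, spend the first part on the estimate at \<open>2 x\<close> and the second on the error
  \<open>g (2 x) - 2 g x\<close>; both then yield the bound claimed at \<open>x\<close>. So all iterates
  \<open>g (2 ^ n x) / 2 ^ n\<close> satisfy one estimate relative to \<open>g x\<close>
  (\<open>doubling_iterates_estimate\<close>). Applied at \<open>2 ^ n x\<close> it shows that they form a Cauchy
  sequence, because rescaling by \<open>2 ^ n\<close> leaves the control \<open>L ^ n \<psi> x\<close>, and in the limit
  it gives the estimate between \<open>g\<close> and \<open>A\<close> (\<open>hyers_limit_estimate\<close>), which concerns \<open>f\<close>
  itself when \<open>f 0 = 0\<close>.

  Additivity comes from \<open>y = x + z\<close>, where the inequality compares \<open>f (x + z) + f 0\<close> with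
  \<open>f x + f z\<close>; rescaling kills both the error and \<open>f 0\<close>. Uniqueness holds because any
  additive \<open>B\<close> satisfying the estimate is itself the fuzzy limit of the iterates
  (\<open>additive_approximation_is_limit\<close>). For \<open>L \<le> 0\<close> the contraction condition forces
  \<open>\<phi> = 0\<close>, and \<open>L\<close> may be replaced by \<open>1 / 2\<close>.
\<close>

section \<open>The lower bound \<open>t / (t + a)\<close>\<close>

lemma ratio_antimono:
  fixes a b t :: real
  assumes "t > 0" "0 \<le> a" "a \<le> b"
  shows "t / (t + b) \<le> t / (t + a)"
  using assms by (intro divide_left_mono) auto

lemma ratio_cancel:
  fixes a c t :: real
  assumes "c > 0"
  shows "c * t / (c * t + c * a) = t / (t + a)"
  using assms by (simp flip: distrib_left)

lemma ratio_tendsto_one: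
  fixes c t :: real
  assumes "c > 0" "t > 0" "q \<longlonglongrightarrow> 0"
  shows "(\<lambda>n. c * t / (c * t + q n)) \<longlonglongrightarrow> 1"
proof -
  have "(\<lambda>n. c * t / (c * t + q n)) \<longlonglongrightarrow> c * t / (c * t + 0)"
    using assms by (intro tendsto_intros) auto
  then show ?thesis using assms by simp
qed

lemma geometric_tendsto_zero:
  fixes L a :: real
  assumes "0 < L" "L < 1"
  shows "(\<lambda>n. L ^ n * a) \<longlonglongrightarrow> 0"
  using assms by (intro tendsto_mult_left_zero LIMSEQ_realpow_zero) auto

text \<open>The two powers of \<open>2\<close>, from the scaling of the norm and from the growth of the control
  along doublings, cancel and leave a factor \<open>L ^ n\<close>.\<close>

lemma ratio_doubling:
  fixes c t L :: real
  assumes "c > 0" "t > 0" "0 < L" "\<And>n. 0 \<le> a n" "\<And>n. a (Suc n) \<le> 2 * L * a n"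
  shows "c * (2 ^ n * t) / (c * (2 ^ n * t) + a n) \<ge> c * t / (c * t + L ^ n * a 0)"
proof -
  have growth: "a n \<le> 2 ^ n * (L ^ n * a 0)"
  proof (induction n)
    case (Suc n)
    have "a (Suc n) \<le> 2 * L * a n" by (rule assms)
    also have "\<dots> \<le> 2 * L * (2 ^ n * (L ^ n * a 0))"
      using Suc assms by (intro mult_left_mono) auto
    finally show ?case by (simp add: mult_ac)
  qed simp
  have "c * t / (c * t + L ^ n * a 0)
      = 2 ^ n * (c * t) / (2 ^ n * (c * t) + 2 ^ n * (L ^ n * a 0))"
    by (rule ratio_cancel[symmetric]) simp
  also have "\<dots> \<le> 2 ^ n * (c * t) / (2 ^ n * (c * t) + a n)"
    using growth assms by (intro ratio_antimono) auto
  finally show ?thesis by (simp add: mult_ac)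
qed

section \<open>Fuzzy limits\<close>

context fuzzy_norm
begin

lemma norm_zero: "t > 0 \<Longrightarrow> N 0 t = 1"
  using zero_iff by blast

lemma norm_minus: "N (- x) t = N x t"
  using scale[of "-1" x t] by simp

lemma norm_diff_commute: "N (x - y) t = N (y - x) t"
  using norm_minus[of "x - y" t] by simp

lemma norm_scale_pos: "c > 0 \<Longrightarrow> N (x /\<^sub>R c) t = N x (c * t)"
  using scale[of "inverse c" x t] by (simp add: field_simps)

lemma tendsto_one_if_ge:
  assumes "\<And>n. b n \<le> N (s n) t" "b \<longlonglongrightarrow> 1"
  shows "(\<lambda>n. N (s n) t) \<longlonglongrightarrow> 1"
  by (rule tendsto_sandwich[OF _ _ assms(2) tendsto_const]) (auto simp: assms(1) le_one)

lemma fuzzy_tendsto_add: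
  assumes "fuzzy_tendsto N s x" "fuzzy_tendsto N u y"
  shows "fuzzy_tendsto N (\<lambda>n. s n + u n) (x + y)"
  unfolding fuzzy_tendsto_def
proof (intro allI impI)
  fix t :: real assume t: "t > 0"
  show "(\<lambda>n. N (s n + u n - (x + y)) t) \<longlonglongrightarrow> 1"
  proof (rule tendsto_one_if_ge)
    show "min (N (s n - x) (t / 2)) (N (u n - y) (t / 2)) \<le> N (s n + u n - (x + y)) t" for n
      using triangle[of "s n - x" "t / 2" "u n - y" "t / 2"] by (simp add: algebra_simps)
    have "(\<lambda>n. min (N (s n - x) (t / 2)) (N (u n - y) (t / 2))) \<longlonglongrightarrow> min 1 1"
      using assms t unfolding fuzzy_tendsto_def by (intro tendsto_min) auto
    then show "(\<lambda>n. min (N (s n - x) (t / 2)) (N (u n - y) (t / 2))) \<longlonglongrightarrow> 1" by simp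
  qed
qed

lemma fuzzy_tendsto_minus:
  assumes "fuzzy_tendsto N s x"
  shows "fuzzy_tendsto N (\<lambda>n. - s n) (- x)"
proof -
  have "N (- s n - - x) t = N (s n - x) t" for n t
    by (simp add: norm_diff_commute)
  then show ?thesis using assms by (simp add: fuzzy_tendsto_def)
qed

lemma fuzzy_tendsto_diff:
  assumes "fuzzy_tendsto N s x" "fuzzy_tendsto N u y"
  shows "fuzzy_tendsto N (\<lambda>n. s n - u n) (x - y)"
  using fuzzy_tendsto_add[OF assms(1) fuzzy_tendsto_minus[OF assms(2)]] by simp

lemma fuzzy_tendsto_unique:
  assumes "fuzzy_tendsto N s x" "fuzzy_tendsto N s y"
  shows "x = y"
proof -
  have "fuzzy_tendsto N (\<lambda>n. 0) (x - y)"
    using fuzzy_tendsto_diff[OF assms] by simp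
  then have "\<forall>t>0. N (x - y) t = 1"
    by (simp add: fuzzy_tendsto_def LIMSEQ_const_iff norm_diff_commute)
  then show ?thesis using zero_iff[of "x - y"] by simp
qed

lemma fuzzy_tendsto_halving: "fuzzy_tendsto N (\<lambda>n. v /\<^sub>R 2 ^ n) 0"
  unfolding fuzzy_tendsto_def
proof (intro allI impI)
  fix t :: real assume t: "t > 0"
  have "filterlim (\<lambda>n. 2 ^ n :: real) at_top sequentially"
    by (intro filterlim_at_infinity_imp_filterlim_at_top filterlim_realpow_sequentially_gt1) auto
  then have "filterlim (\<lambda>n. 2 ^ n * t) at_top sequentially"
    using t by (intro filterlim_at_top_mult_tendsto_pos[OF tendsto_const])
  from filterlim_compose[OF tendsto_one this]
  show "(\<lambda>n. N (v /\<^sub>R 2 ^ n - 0) t) \<longlonglongrightarrow> 1"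
    by (simp add: norm_scale_pos)
qed

text \<open>Passing to the limit costs an arbitrarily small share \<open>t - r\<close> of the time \<open>t\<close>; the loss
  disappears because the bound is continuous from the left.\<close>

lemma limit_norm_ge:
  assumes lim: "fuzzy_tendsto N s x"
    and bound: "\<And>n r. r > 0 \<Longrightarrow> b r \<le> N (s n - y) r"
    and left: "(b \<longlongrightarrow> b t) (at_left t)" and t: "t > 0"
  shows "b t \<le> N (x - y) t"
proof -
  have *: "b r \<le> N (x - y) t" if r: "0 < r" "r < t" for r
  proof (rule ccontr)
    assume less: "\<not> b r \<le> N (x - y) t"
    have "b r \<le> 1" using bound[OF r(1)] le_one order_trans by blast
    then have "N (x - y) t < 1" using less by simp
    moreover have "(\<lambda>n. N (s n - x) (t - r)) \<longlonglongrightarrow> 1"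
      using lim r by (simp add: fuzzy_tendsto_def)
    ultimately have "\<forall>\<^sub>F n in sequentially. N (x - y) t < N (s n - x) (t - r)"
      by (rule order_tendstoD(1)[rotated])
    then obtain n where n: "N (x - y) t < N (s n - x) (t - r)"
      by (auto dest: eventually_happens'[OF sequentially_bot])
    have "min (N (x - s n) (t - r)) (N (s n - y) r) \<le> N (x - y) t"
      using triangle[of "x - s n" "t - r" "s n - y" r] by simp
    then show False
      using n less bound[OF r(1), of n] by (simp add: norm_diff_commute[of x] min_le_iff_disj)
  qed
  have "\<forall>\<^sub>F r in at_left t. r \<in> {0<..<t}"
    using t by (rule eventually_at_left_real)
  then have "\<forall>\<^sub>F r in at_left t. b r \<le> N (x - y) t"
    by eventually_elim (auto intro: *)
  then show ?thesis
    using left by (intro tendsto_upperbound) auto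
qed

end

section \<open>Hyers' direct method for approximately doubling maps\<close>

locale approx_doubling = fuzzy_norm N for N :: "'b::real_vector \<Rightarrow> real \<Rightarrow> real" +
  fixes g :: "'a::real_vector \<Rightarrow> 'b" and \<psi> :: "'a \<Rightarrow> real" and L :: real
  assumes L: "0 < L" "L < 1"
    and psi_nonneg: "0 \<le> \<psi> x"
    and psi_double: "\<psi> (2 *\<^sub>R x) \<le> 2 * L * \<psi> x"
    and doubling: "t > 0 \<Longrightarrow> t / (t + \<psi> x) \<le> N (g (2 *\<^sub>R x) - 2 *\<^sub>R g x) t"
begin

text \<open>The constant \<open>2 - 2 L\<close> is the one for which the two parts of the split
  \<open>t = L t + (1 - L) t\<close> contribute the same bound, so the estimate does not deteriorate
  with \<open>n\<close>.\<close>

lemma doubling_iterates_estimate: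
  assumes "t > 0"
  shows "(2 - 2 * L) * t / ((2 - 2 * L) * t + \<psi> x) \<le> N (g (2 ^ n *\<^sub>R x) /\<^sub>R 2 ^ n - g x) t"
  using assms
proof (induction n arbitrary: x t)
  case 0
  have "(2 - 2 * L) * t / ((2 - 2 * L) * t + \<psi> x) \<le> 1"
    using 0 L psi_nonneg[of x] by (auto simp: divide_le_eq_1 not_less mult_pos_pos add_pos_nonneg)
  then show ?case using 0 by (simp add: norm_zero)
next
  case (Suc n)
  define c where "c = 2 - 2 * L"
  have c: "c > 0" using L by (simp add: c_def)
  define u where "u = g (2 ^ n *\<^sub>R 2 *\<^sub>R x) /\<^sub>R 2 ^ n - g (2 *\<^sub>R x)"
  define v where "v = g (2 *\<^sub>R x) - 2 *\<^sub>R g x"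
  have "c * t / (c * t + \<psi> x) = (2 * L) * (c * t) / ((2 * L) * (c * t) + (2 * L) * \<psi> x)"
    using L by (intro ratio_cancel[symmetric]) auto
  also have "\<dots> \<le> (2 * L) * (c * t) / ((2 * L) * (c * t) + \<psi> (2 *\<^sub>R x))"
    using L c Suc.prems by (intro ratio_antimono psi_nonneg psi_double) auto
  also have "\<dots> \<le> N u (2 * (L * t))"
    using Suc.IH[of "2 * (L * t)" "2 *\<^sub>R x"] L Suc.prems by (simp add: u_def c_def mult_ac)
  finally have u: "c * t / (c * t + \<psi> x) \<le> N (u /\<^sub>R 2) (L * t)"
    by (subst norm_scale_pos) auto
  have "c * t / (c * t + \<psi> x) \<le> N v (2 * ((1 - L) * t))"
    using doubling[of "c * t" x] c Suc.prems by (simp add: v_def c_def algebra_simps)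
  then have v: "c * t / (c * t + \<psi> x) \<le> N (v /\<^sub>R 2) ((1 - L) * t)"
    by (subst norm_scale_pos) auto
  have "c * t / (c * t + \<psi> x) \<le> N (u /\<^sub>R 2 + v /\<^sub>R 2) (L * t + (1 - L) * t)"
    using u v by (intro order_trans[OF _ triangle]) simp
  also have "u /\<^sub>R 2 + v /\<^sub>R 2 = g (2 ^ Suc n *\<^sub>R x) /\<^sub>R 2 ^ Suc n - g x"
    by (simp add: u_def v_def scaleR_right_diff_distrib mult_ac)
  also have "L * t + (1 - L) * t = t"
    by (simp add: algebra_simps)
  finally show ?case by (simp add: c_def)
qed

lemma fuzzy_Cauchy_doubling_iterates:
  "fuzzy_Cauchy N (\<lambda>n. g (2 ^ n *\<^sub>R x) /\<^sub>R 2 ^ n)"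
  unfolding fuzzy_Cauchy_def
proof (intro allI impI)
  fix e t :: real assume e: "e > 0" and t: "t > 0"
  define c where "c = 2 - 2 * L"
  have c: "c > 0" using L by (simp add: c_def)
  let ?s = "\<lambda>n. g (2 ^ n *\<^sub>R x) /\<^sub>R 2 ^ n"
  have bound: "c * t / (c * t + L ^ n * \<psi> x) \<le> N (?s (n + p) - ?s n) t" for n p
  proof -
    have "c * t / (c * t + L ^ n * \<psi> x)
        \<le> c * (2 ^ n * t) / (c * (2 ^ n * t) + \<psi> (2 ^ n *\<^sub>R x))"
      using ratio_doubling[of c t L "\<lambda>n. \<psi> (2 ^ n *\<^sub>R x)" n] c t L psi_nonneg
        psi_double[of "2 ^ k *\<^sub>R x" for k] by simp
    also have "\<dots> \<le> N (g (2 ^ p *\<^sub>R 2 ^ n *\<^sub>R x) /\<^sub>R 2 ^ p - g (2 ^ n *\<^sub>R x)) (2 ^ n * t)"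
      using doubling_iterates_estimate[of "2 ^ n * t" "2 ^ n *\<^sub>R x" p] t by (simp add: c_def)
    also have "\<dots> = N (?s (n + p) - ?s n) t"
      by (subst norm_scale_pos[symmetric]) (simp_all add: scaleR_right_diff_distrib power_add mult_ac)
    finally show ?thesis .
  qed
  have "(\<lambda>n. c * t / (c * t + L ^ n * \<psi> x)) \<longlonglongrightarrow> 1"
    using c t L by (intro ratio_tendsto_one geometric_tendsto_zero) auto
  then have "\<forall>\<^sub>F n in sequentially. 1 - e < c * t / (c * t + L ^ n * \<psi> x)"
    by (rule order_tendstoD) (use e in simp)
  then show "\<exists>n0. \<forall>n\<ge>n0. \<forall>p>0. 1 - e < N (?s (n + p) - ?s n) t"
    unfolding eventually_sequentially using bound by (meson less_le_trans)
qed

lemma hyers_limit_estimate: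
  assumes lim: "fuzzy_tendsto N (\<lambda>n. g (2 ^ n *\<^sub>R x) /\<^sub>R 2 ^ n) a" and t: "t > 0"
  shows "(2 - 2 * L) * t / ((2 - 2 * L) * t + \<psi> x) \<le> N (g x - a) t"
proof -
  have "(2 - 2 * L) * t > 0" using L t by simp
  then have "(2 - 2 * L) * t + \<psi> x \<noteq> 0" using psi_nonneg[of x] by linarith
  then have "((\<lambda>r. (2 - 2 * L) * r / ((2 - 2 * L) * r + \<psi> x))
      \<longlongrightarrow> (2 - 2 * L) * t / ((2 - 2 * L) * t + \<psi> x)) (at_left t)"
    by (intro tendsto_intros)
  from limit_norm_ge[OF lim doubling_iterates_estimate this t] show ?thesis
    by (simp add: norm_diff_commute)
qed

end

text \<open>For an additive map \<open>B\<close> the rescaled values \<open>B (2 ^ n x) / 2 ^ n\<close> are constant, so the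
  estimate at \<open>2 ^ n x\<close> is an estimate at \<open>x\<close> whose control decays like \<open>L ^ n\<close>.\<close>

lemma (in fuzzy_norm) additive_approximation_is_limit:
  fixes f B :: "'a::real_vector \<Rightarrow> 'b"
  assumes L: "0 < L" "L < 1" and c: "c > 0"
    and psi: "\<And>x. 0 \<le> \<psi> x" "\<And>x. \<psi> (2 *\<^sub>R x) \<le> 2 * L * \<psi> x"
    and B: "additive B"
    and est: "\<And>x t. t > 0 \<Longrightarrow> c * t / (c * t + \<psi> x) \<le> N (f x - B x) t"
  shows "fuzzy_tendsto N (\<lambda>n. f (2 ^ n *\<^sub>R x) /\<^sub>R 2 ^ n) (B x)"
  unfolding fuzzy_tendsto_def
proof (intro allI impI)
  fix t :: real assume t: "t > 0"
  have B_double: "B (2 *\<^sub>R y) = 2 *\<^sub>R B y" for y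
    using additive.add[OF B, of y y] by (simp add: scaleR_2)
  have B_pow: "B (2 ^ n *\<^sub>R x) = 2 ^ n *\<^sub>R B x" for n
  proof (induction n)
    case (Suc n)
    then show ?case using B_double[of "2 ^ n *\<^sub>R x"] by simp
  qed simp
  show "(\<lambda>n. N (f (2 ^ n *\<^sub>R x) /\<^sub>R 2 ^ n - B x) t) \<longlonglongrightarrow> 1"
  proof (rule tendsto_one_if_ge)
    fix n
    have "c * t / (c * t + L ^ n * \<psi> x)
        \<le> c * (2 ^ n * t) / (c * (2 ^ n * t) + \<psi> (2 ^ n *\<^sub>R x))"
      using ratio_doubling[of c t L "\<lambda>n. \<psi> (2 ^ n *\<^sub>R x)" n] c t L psi(1)
        psi(2)[of "2 ^ k *\<^sub>R x" for k] by simp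
    also have "\<dots> \<le> N (f (2 ^ n *\<^sub>R x) - B (2 ^ n *\<^sub>R x)) (2 ^ n * t)"
      using t by (intro est) simp
    also have "\<dots> = N (f (2 ^ n *\<^sub>R x) /\<^sub>R 2 ^ n - B x) t"
      by (subst norm_scale_pos[symmetric]) (simp_all add: scaleR_right_diff_distrib B_pow)
    finally show "c * t / (c * t + L ^ n * \<psi> x) \<le> N (f (2 ^ n *\<^sub>R x) /\<^sub>R 2 ^ n - B x) t" .
  next
    show "(\<lambda>n. c * t / (c * t + L ^ n * \<psi> x)) \<longlonglongrightarrow> 1"
      using c t L by (intro ratio_tendsto_one geometric_tendsto_zero) auto
  qed
qed

text \<open>This transfers limits from \<open>f - f 0\<close> back to \<open>f\<close>, since \<open>v / 2 ^ n\<close> tends to \<open>0\<close>.\<close>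

lemma (in fuzzy_norm) fuzzy_tendsto_iterates_shift:
  assumes "fuzzy_tendsto N (\<lambda>n. (f (2 ^ n *\<^sub>R x) - v) /\<^sub>R 2 ^ n) a"
  shows "fuzzy_tendsto N (\<lambda>n. f (2 ^ n *\<^sub>R x) /\<^sub>R 2 ^ n) a"
  using fuzzy_tendsto_add[OF assms fuzzy_tendsto_halving[of v]]
  by (simp add: scaleR_right_diff_distrib)

text \<open>The rescaled defect \<open>f (x + z) + v - f x - f z\<close> tends to \<open>0\<close> by the control, and to
  \<open>A (x + z) - A x - A z\<close> because the constant \<open>v\<close> is rescaled away; fuzzy limits are
  unique.\<close>

lemma (in fuzzy_norm) limit_additive:
  fixes f A :: "'a::real_vector \<Rightarrow> 'b"
  assumes L: "0 < L" "L < 1"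
    and chi: "\<And>x z. 0 \<le> \<chi> x z" "\<And>x z. \<chi> (2 *\<^sub>R x) (2 *\<^sub>R z) \<le> 2 * L * \<chi> x z"
    and est: "\<And>x z t. t > 0 \<Longrightarrow> t / (t + \<chi> x z) \<le> N (f (x + z) + v - f x - f z) t"
    and lim: "\<And>x. fuzzy_tendsto N (\<lambda>n. f (2 ^ n *\<^sub>R x) /\<^sub>R 2 ^ n) (A x)"
  shows "additive A"
proof
  fix x z
  let ?d = "\<lambda>n. f (2 ^ n *\<^sub>R (x + z)) /\<^sub>R 2 ^ n + v /\<^sub>R 2 ^ n
    - f (2 ^ n *\<^sub>R x) /\<^sub>R 2 ^ n - f (2 ^ n *\<^sub>R z) /\<^sub>R 2 ^ n"
  have "fuzzy_tendsto N ?d (A (x + z) + 0 - A x - A z)"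
    by (intro fuzzy_tendsto_diff fuzzy_tendsto_add lim fuzzy_tendsto_halving)
  moreover have "fuzzy_tendsto N ?d 0"
    unfolding fuzzy_tendsto_def
  proof (intro allI impI)
    fix t :: real assume t: "t > 0"
    show "(\<lambda>n. N (?d n - 0) t) \<longlonglongrightarrow> 1"
    proof (rule tendsto_one_if_ge)
      fix n
      have "1 * t / (1 * t + L ^ n * \<chi> x z)
          \<le> 1 * (2 ^ n * t) / (1 * (2 ^ n * t) + \<chi> (2 ^ n *\<^sub>R x) (2 ^ n *\<^sub>R z))"
        using ratio_doubling[of 1 t L "\<lambda>n. \<chi> (2 ^ n *\<^sub>R x) (2 ^ n *\<^sub>R z)" n] t L chi(1)
          chi(2)[of "2 ^ k *\<^sub>R x" "2 ^ k *\<^sub>R z" for k] by simp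
      also have "\<dots> \<le> N (f (2 ^ n *\<^sub>R x + 2 ^ n *\<^sub>R z) + v - f (2 ^ n *\<^sub>R x) - f (2 ^ n *\<^sub>R z))
          (2 ^ n * t)"
        using est[of "2 ^ n * t"] t by simp
      also have "\<dots> = N (?d n - 0) t"
        by (subst norm_scale_pos[symmetric]) (simp_all add: scaleR_right_diff_distrib scaleR_right_distrib)
      finally show "1 * t / (1 * t + L ^ n * \<chi> x z) \<le> N (?d n - 0) t" .
    next
      show "(\<lambda>n. 1 * t / (1 * t + L ^ n * \<chi> x z)) \<longlonglongrightarrow> 1"
        using t L by (intro ratio_tendsto_one geometric_tendsto_zero) auto
    qed
  qed
  ultimately have "A (x + z) + 0 - A x - A z = 0"
    by (rule fuzzy_tendsto_unique)
  then show "A (x + z) = A x + A z"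
    by (simp add: algebra_simps)
qed

section \<open>Stability of the functional equation\<close>


theorem theorem4p7:
  fixes N :: "'b::real_vector \<Rightarrow> real \<Rightarrow> real"
    and \<phi> :: "'a::real_vector \<Rightarrow> 'a \<Rightarrow> 'a \<Rightarrow> real"
    and f :: "'a \<Rightarrow> 'b"
    and L :: real
  assumes "fuzzy_banach N"
    and "\<And>x y z. 0 \<le> \<phi> x y z"
    and "L < 1"
    and "\<And>x y z. \<phi> x y z \<le> 2 * L * \<phi> (x /\<^sub>R 2) (y /\<^sub>R 2) (z /\<^sub>R 2)"
    and "\<And>x y z t. t > 0 \<Longrightarrow>
      N (f ((x + y + z) /\<^sub>R 2) + f ((x - y + z) /\<^sub>R 2) - f x - f z) t
        \<ge> t / (t + \<phi> x y z)"
  shows "\<exists>A. (\<forall>x. fuzzy_tendsto N (\<lambda>n. f (2 ^ n *\<^sub>R x) /\<^sub>R 2 ^ n) (A x))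
    \<and> additive A
    \<and> (f 0 = 0 \<longrightarrow> (\<forall>x. \<forall>t>0. N (f x - A x) t
          \<ge> (2 - 2 * L) * t / ((2 - 2 * L) * t + \<phi> x (2 *\<^sub>R x) x)))
    \<and> (\<forall>B. additive B
          \<and> (\<forall>x. \<forall>t>0. N (f x - B x) t
              \<ge> (2 - 2 * L) * t / ((2 - 2 * L) * t + \<phi> x (2 *\<^sub>R x) x))
          \<longrightarrow> B = A)"
proof -
  interpret fuzzy_banach N by (rule assms(1))
  define \<psi> where "\<psi> x = \<phi> x (2 *\<^sub>R x) x" for x
  have psi_nonneg: "0 \<le> \<psi> x" for x
    by (simp add: \<psi>_def assms(2))
  \<comment> \<open>For \<open>L \<le> 0\<close> the control vanishes, so \<open>L\<close> may be replaced by a positive constant \<open>K\<close>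
    without changing the stability estimate.\<close>
  obtain K where K: "0 < K" "K < 1"
    and phi_double: "\<And>x y z. \<phi> (2 *\<^sub>R x) (2 *\<^sub>R y) (2 *\<^sub>R z) \<le> 2 * K * \<phi> x y z"
    and bound_eq: "\<And>x t. t > 0 \<Longrightarrow>
      (2 - 2 * L) * t / ((2 - 2 * L) * t + \<psi> x) = (2 - 2 * K) * t / ((2 - 2 * K) * t + \<psi> x)"
  proof (cases "L > 0")
    case True
    show ?thesis
    proof (rule that[of L])
      show "\<phi> (2 *\<^sub>R x) (2 *\<^sub>R y) (2 *\<^sub>R z) \<le> 2 * L * \<phi> x y z" for x y z
        using assms(4)[of "2 *\<^sub>R x" "2 *\<^sub>R y" "2 *\<^sub>R z"] by simp
    qed (use True assms(3) in auto)
  next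
    case False
    have zero: "\<phi> x y z = 0" for x y z
    proof -
      have "2 * L * \<phi> (x /\<^sub>R 2) (y /\<^sub>R 2) (z /\<^sub>R 2) \<le> 0"
        using False assms(2)[of "x /\<^sub>R 2" "y /\<^sub>R 2" "z /\<^sub>R 2"]
        by (intro mult_nonpos_nonneg[of "2 * L"]) linarith+
      then show ?thesis
        using assms(2)[of x y z] assms(4)[of x y z] by linarith
    qed
    have "2 - 2 * L > 0" using assms(3) by simp
    then show ?thesis
      using that[of "1 / 2"] by (simp add: zero \<psi>_def)
  qed
  have psi_double: "\<psi> (2 *\<^sub>R x) \<le> 2 * K * \<psi> x" for x
    unfolding \<psi>_def by (rule phi_double)
  define g where "g x = f x - f 0" for x
  interpret g: approx_doubling N g \<psi> K
  proof
    show "t / (t + \<psi> x) \<le> N (g (2 *\<^sub>R x) - 2 *\<^sub>R g x) t" if "t > 0" for t x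
    proof -
      have "x + 2 *\<^sub>R x + x = 2 *\<^sub>R 2 *\<^sub>R x" "x - 2 *\<^sub>R x + x = 0"
        unfolding scaleR_2 by (simp_all add: add_ac)
      then have "t / (t + \<psi> x) \<le> N (f (2 *\<^sub>R x) + f 0 - f x - f x) t"
        using assms(5)[OF that, of x "2 *\<^sub>R x" x] by (simp add: \<psi>_def)
      also have "f (2 *\<^sub>R x) + f 0 - f x - f x = g (2 *\<^sub>R x) - 2 *\<^sub>R g x"
        by (simp add: g_def scaleR_2)
      finally show ?thesis .
    qed
  qed (use K psi_nonneg psi_double in auto)
  have "\<exists>a. fuzzy_tendsto N (\<lambda>n. g (2 ^ n *\<^sub>R x) /\<^sub>R 2 ^ n) a" for x
    by (rule complete[OF g.fuzzy_Cauchy_doubling_iterates])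
  then obtain A where lim_g: "\<And>x. fuzzy_tendsto N (\<lambda>n. g (2 ^ n *\<^sub>R x) /\<^sub>R 2 ^ n) (A x)"
    by metis
  have lim: "fuzzy_tendsto N (\<lambda>n. f (2 ^ n *\<^sub>R x) /\<^sub>R 2 ^ n) (A x)" for x
    using lim_g[of x] unfolding g_def by (rule fuzzy_tendsto_iterates_shift)
  have "additive A"
  proof (rule limit_additive[where \<chi> = "\<lambda>x z. \<phi> x (x + z) z" and f = f and L = K and v = "f 0"])
    show "t / (t + \<phi> x (x + z) z) \<le> N (f (x + z) + f 0 - f x - f z) t" if "t > 0" for x z t
    proof -
      have "x + (x + z) + z = 2 *\<^sub>R (x + z)" "x - (x + z) + z = 0"
        unfolding scaleR_2 by (simp_all add: add_ac)
      then show ?thesis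
        using assms(5)[OF that, of x "x + z" z] by simp
    qed
    show "\<phi> (2 *\<^sub>R x) (2 *\<^sub>R x + 2 *\<^sub>R z) (2 *\<^sub>R z) \<le> 2 * K * \<phi> x (x + z) z" for x z
      using phi_double[of x "x + z" z] by (simp add: scaleR_add_right)
  qed (use K assms(2) lim in auto)
  moreover have "(2 - 2 * L) * t / ((2 - 2 * L) * t + \<phi> x (2 *\<^sub>R x) x) \<le> N (f x - A x) t"
    if "f 0 = 0" "t > 0" for x t
    using g.hyers_limit_estimate[OF lim_g that(2)] bound_eq[OF that(2)] that(1)
    by (simp add: \<psi>_def g_def)
  moreover have "B = A"
    if B: "additive B" and est: "\<And>x t. t > 0 \<Longrightarrow>
      (2 - 2 * L) * t / ((2 - 2 * L) * t + \<phi> x (2 *\<^sub>R x) x) \<le> N (f x - B x) t" for B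
  proof
    fix x
    have "fuzzy_tendsto N (\<lambda>n. f (2 ^ n *\<^sub>R x) /\<^sub>R 2 ^ n) (B x)"
    proof (rule additive_approximation_is_limit[where \<psi> = \<psi> and c = "2 - 2 * L"])
      show "(2 - 2 * L) * t / ((2 - 2 * L) * t + \<psi> x) \<le> N (f x - B x) t" if "t > 0" for x t
        unfolding \<psi>_def using that by (rule est)
    qed (use K assms(3) B psi_nonneg psi_double in auto)
    then show "B x = A x"
      using lim by (rule fuzzy_tendsto_unique)
  qed
  ultimately show ?thesis
    using lim by blast
qed

end
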